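(* Let $(\mu_t)_{t\in[0,1]}\subset\mathcal P(\mathbb R)$ and $\lambda\in\mathcal P(C([0,1],\mathbb R))$ be the curve of measures and the measure on paths defined in the context. If $\lambda^1,\lambda^2\in\mathcal P(C([0,1],\mathbb R))$ are such that $(\mathrm e_t)_\sharp\lambda^1=(\mathrm e_t)_\sharp\lambda^2=\mu_t$ for all $t\in[0,1]$, then $\lambda^1=\lambda^2$. In particular, $\lambda$ is the only admissible lifting of $(\mu_t)_{t\in[0,1]}$, i.e. the only element of $\mathcal P(C([0,1],\mathbb R))$ whose time marginals are $(\mu_t)_{t\in[0,1]}$.
   Context: $\mathrm e_t(\gamma)=\gamma(t)$ is the evaluation map on $C([0,1],\mathbb R)$, and $\mathcal P(\cdot)$ denotes Borel probability measures. Construction. Let $\Omega=\{0,1\}^{\mathbb N}$ (with $\mathbb N=\{0,1,2,\dots\}$) with the product topology and $\mathbb P=(\tfrac12\delta_0+\tfrac12\delta_1)^{\infty}$. Let $t_0=0$ and $t_{k+1}=t_k+2^{-(k+1)}$ for $k\ge 0$. For $\boldsymbol\omega=(\omega_0,\omega_1,\dots)\in\Omega$ define, for $t\in[0,1]$, $$\tilde\gamma_{\boldsymbol\omega}(t)=\sum_{k\ge 0}\omega_k\big((t-t_k)_+\wedge(t_{k+1}-t_k)\big),\qquad \gamma_{\boldsymbol\omega}(t)=(1-t)\,\tilde\gamma_{\boldsymbol\omega}(t).$$ Let $\iota:\Omega\to C([0,1],\mathbb R)$, $\iota(\boldsymbol\omega)=\gamma_{\boldsymbol\omega}$, and set $\lambda:=\iota_\sharp\mathbb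 P$ and $\mu_t:=(\mathrm e_t)_\sharp\lambda$ for $t\in[0,1]$. *)

theory Defs
  imports "HOL-Probability.Probability"
begin

text \<open>
  C([0,1],R) with the supremum metric. Its elements are functions on the reals that are
  continuous on the unit interval and take the value \<^const>\<open>undefined\<close> outside of it; the
  boundedness required by \<^const>\<open>cfunspace\<close> is automatic, since the domain is compact.
\<close>

definition C01 :: "(real \<Rightarrow> real) metric" where
  "C01 = cfunspace (top_of_set {0..1}) euclidean_metric"

definition borel_C01 :: "(real \<Rightarrow> real) measure" where
  "borel_C01 = sigma (mspace C01) {U. openin (mtopology_of C01) U}"

definition eval_at :: "real \<Rightarrow> (real \<Rightarrow> real) \<Rightarrow> real" where
  "eval_at t \<gamma> = \<gamma> t"

text \<open>
  The space of \<open>coin_seq\<close> is \<open>UNIV \<rightarrow>\<^sub>E {0,1}\<close>, and \<open>uniform_count_measure {0,1}\<close> gives mass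
  1/2 to each of 0 and 1. The product sigma-algebra is the Borel sigma-algebra of the product
  topology, as there are countably many factors, each finite and discrete.
\<close>

definition coin_seq :: "(nat \<Rightarrow> nat) measure" where
  "coin_seq = PiM UNIV (\<lambda>_. uniform_count_measure {0, 1})"

primrec knot :: "nat \<Rightarrow> real" where
  "knot 0 = 0"
| "knot (Suc k) = knot k + 1 / 2 ^ (k + 1)"

definition coin_path_tilde :: "(nat \<Rightarrow> nat) \<Rightarrow> real \<Rightarrow> real" where
  "coin_path_tilde \<omega> t = (\<Sum>k. real (\<omega> k) * min (max (t - knot k) 0) (knot (Suc k) - knot k))"

definition coin_path :: "(nat \<Rightarrow> nat) \<Rightarrow> real \<Rightarrow> real" where
  "coin_path \<omega> = (\<lambda>t\<in>{0..1}. (1 - t) * coin_path_tilde \<omega> t)"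

definition path_law :: "(real \<Rightarrow> real) measure" where
  "path_law = distr coin_seq borel_C01 coin_path"

definition marginal :: "real \<Rightarrow> real measure" where
  "marginal t = distr path_law borel (eval_at t)"

text \<open>
  The elements of \<open>space (prob_algebra M)\<close> are the probability measures on the sigma-algebra
  of \<open>M\<close>.
\<close>

definition admissible_lifting :: "(real \<Rightarrow> real measure) \<Rightarrow> (real \<Rightarrow> real) measure \<Rightarrow> bool" where
  "admissible_lifting m l \<longleftrightarrow>
     l \<in> space (prob_algebra borel_C01) \<and> (\<forall>t\<in>{0..1}. distr l borel (eval_at t) = m t)"


text \<open>
  The maps along which measures are pushed forward above are measurable, so each \<^const>\<open>distr\<close>
  is a genuine image measure.
\<close>

lemma space_borel_C01: "space borel_C01 = mspace C01"
  by (simp add: borel_C01_def space_measure_of_conv)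

lemma mspace_C01: "mspace C01 = {f \<in> extensional {0..1}. continuous_on {0..1} f}"
  unfolding C01_def
  by (subst compactin_mspace_cfunspace) (auto simp: compactin_subtopology)

lemma sets_borel_C01: "sets borel_C01 = sigma_sets (mspace C01) {U. openin (mtopology_of C01) U}"
  unfolding borel_C01_def
  by (rule sets_measure_of) (auto dest!: openin_subset)

lemma mdist_C01_le:
  assumes "f \<in> mspace C01" "g \<in> mspace C01"
  shows "mdist C01 f g \<le> a \<longleftrightarrow> (\<forall>x\<in>{0..1}. \<bar>f x - g x\<bar> \<le> a)"
  using assms unfolding C01_def by (subst cfunspace_mdist_le) (auto simp: dist_real_def)

lemma measurable_eval_at:
  assumes "t \<in> {0..1}"
  shows "eval_at t \<in> borel_C01 \<rightarrow>\<^sub>M borel"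
proof (rule borel_measurableI)
  fix S :: "real set" assume "open S"
  have "openin (mtopology_of C01) {f \<in> mspace C01. f t \<in> S}"
    unfolding mtopology_of_def Metric_space.openin_mtopology[OF Metric_space_mspace_mdist]
  proof (intro conjI allI impI)
    fix f assume f: "f \<in> {f \<in> mspace C01. f t \<in> S}"
    then obtain r where r: "r > 0" "ball (f t) r \<subseteq> S"
      using \<open>open S\<close> by (auto elim: openE)
    have "Metric_space.mball (mspace C01) (mdist C01) f r \<subseteq> {f \<in> mspace C01. f t \<in> S}"
    proof
      fix g assume "g \<in> Metric_space.mball (mspace C01) (mdist C01) f r"
      then have g: "g \<in> mspace C01" "mdist C01 f g < r"
        by (auto simp: Metric_space.in_mball[OF Metric_space_mspace_mdist])
      then have "\<bar>f t - g t\<bar> < r"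
        using mdist_C01_le[of f g "mdist C01 f g"] f assms by force
      then show "g \<in> {f \<in> mspace C01. f t \<in> S}"
        using g r by (auto simp: dist_real_def)
    qed
    with r show "\<exists>r>0. Metric_space.mball (mspace C01) (mdist C01) f r \<subseteq> {f \<in> mspace C01. f t \<in> S}"
      by blast
  qed auto
  then show "eval_at t -` S \<inter> space borel_C01 \<in> sets borel_C01"
    by (auto simp: sets_borel_C01 space_borel_C01 eval_at_def vimage_def Int_def conj_commute
        intro!: sigma_sets.Basic)
qed

lemma space_coin_seq: "space coin_seq = UNIV \<rightarrow>\<^sub>E {0, 1}"
  by (simp add: coin_seq_def space_PiM space_uniform_count_measure)

lemma coin_seq_le: "\<omega> \<in> space coin_seq \<Longrightarrow> real (\<omega> k) \<le> 1"
  by (auto simp: space_coin_seq PiE_def Pi_def dest!: spec[of _ k])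

lemma path_term_bounds:
  assumes "\<omega> \<in> space coin_seq"
  shows "0 \<le> real (\<omega> k) * min (max (t - knot k) 0) (knot (Suc k) - knot k)"
    and "real (\<omega> k) * min (max (t - knot k) 0) (knot (Suc k) - knot k) \<le> (1/2) ^ Suc k"
proof -
  show "0 \<le> real (\<omega> k) * min (max (t - knot k) 0) (knot (Suc k) - knot k)" by simp
  have "real (\<omega> k) * min (max (t - knot k) 0) (knot (Suc k) - knot k) \<le> 1 * (1/2) ^ Suc k"
    using coin_seq_le[OF assms, of k] by (intro mult_mono) (auto simp: power_one_over)
  then show "real (\<omega> k) * min (max (t - knot k) 0) (knot (Suc k) - knot k) \<le> (1/2) ^ Suc k"
    by simp
qed

lemma summable_half: "summable (\<lambda>k. (1/2::real) ^ Suc k)"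
  by (simp add: summable_geometric)

lemma summable_path:
  assumes "\<omega> \<in> space coin_seq"
  shows "summable (\<lambda>k. real (\<omega> k) * min (max (t - knot k) 0) (knot (Suc k) - knot k))"
  by (rule summable_comparison_test'[OF summable_half])
     (use path_term_bounds[OF assms] in \<open>auto simp del: knot.simps\<close>)

lemma path_in_C01:
  assumes "\<omega> \<in> space coin_seq"
  shows "coin_path \<omega> \<in> mspace C01"
proof -
  have "uniform_limit {0..1}
          (\<lambda>n t. \<Sum>k<n. real (\<omega> k) * min (max (t - knot k) 0) (knot (Suc k) - knot k))
          (coin_path_tilde \<omega>) sequentially"
    unfolding coin_path_tilde_def
    by (rule Weierstrass_m_test[OF _ summable_half])
       (use path_term_bounds[OF assms] in \<open>auto simp del: knot.simps\<close>)
  then have "continuous_on {0..1} (coin_path_tilde \<omega>)"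
    by (rule uniform_limit_theorem[rotated]) (auto intro!: always_eventually continuous_intros)
  then have "continuous_on {0..1} (\<lambda>t. (1 - t) * coin_path_tilde \<omega> t)"
    by (intro continuous_intros)
  then have "continuous_on {0..1} (coin_path \<omega>)"
    by (rule continuous_on_eq) (simp add: coin_path_def)
  then show ?thesis
    by (auto simp: mspace_C01 coin_path_def)
qed

lemma path_dist:
  assumes "\<omega> \<in> space coin_seq" "\<omega>' \<in> space coin_seq" "\<And>k. k < n \<Longrightarrow> \<omega> k = \<omega>' k"
  shows "mdist C01 (coin_path \<omega>) (coin_path \<omega>') \<le> (1/2) ^ n"
proof -
  have "\<bar>coin_path \<omega> t - coin_path \<omega>' t\<bar> \<le> (1/2) ^ n" if t: "t \<in> {0..1}" for t
  proof -
    define a where "a \<omega> k = real (\<omega> k) * min (max (t - knot k) 0) (knot (Suc k) - knot k)"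
      for \<omega> k
    note b = path_term_bounds[where t = t, folded a_def]
    note s = summable_path[where t = t, folded a_def]
    have half: "(\<lambda>k. (1/2::real) ^ Suc (k + n)) sums ((1/2) ^ n)"
      using sums_mult[OF power_half_series, of "(1/2::real) ^ n"] by (simp add: power_add mult_ac)
    have tail: "0 \<le> (\<Sum>k. a \<eta> (k + n))" "(\<Sum>k. a \<eta> (k + n)) \<le> (1/2) ^ n"
      if "\<eta> \<in> space coin_seq" for \<eta>
      using b[OF that] s[OF that] suminf_le[OF _ _ sums_summable[OF half], of "\<lambda>k. a \<eta> (k + n)"]
      by (auto intro!: suminf_nonneg simp: sums_unique[OF half, symmetric] summable_iff_shift
          simp del: power_Suc)
    have "(\<Sum>k<n. a \<omega> k) = (\<Sum>k<n. a \<omega>' k)"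
      by (rule sum.cong) (use assms(3) in \<open>auto simp: a_def\<close>)
    then have "coin_path_tilde \<omega> t - coin_path_tilde \<omega>' t = (\<Sum>k. a \<omega> (k + n)) - (\<Sum>k. a \<omega>' (k + n))"
      using suminf_split_initial_segment[OF s[OF assms(1)], of n]
        suminf_split_initial_segment[OF s[OF assms(2)], of n]
      by (simp add: coin_path_tilde_def a_def[symmetric] del: knot.simps)
    then have "\<bar>coin_path_tilde \<omega> t - coin_path_tilde \<omega>' t\<bar> \<le> (1/2) ^ n"
      using tail[OF assms(1)] tail[OF assms(2)] by linarith
    then have "\<bar>1 - t\<bar> * \<bar>coin_path_tilde \<omega> t - coin_path_tilde \<omega>' t\<bar> \<le> 1 * (1/2) ^ n"
      using t by (intro mult_mono) auto
    then show ?thesis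
      using t by (simp add: coin_path_def abs_mult[symmetric] right_diff_distrib)
  qed
  then show ?thesis
    by (simp add: mdist_C01_le path_in_C01 assms)
qed

lemma measurable_path: "coin_path \<in> coin_seq \<rightarrow>\<^sub>M borel_C01"
  unfolding borel_C01_def
proof (rule measurable_measure_of)
  show "{U. openin (mtopology_of C01) U} \<subseteq> Pow (mspace C01)"
    by (auto dest!: openin_subset)
  show "coin_path \<in> space coin_seq \<rightarrow> mspace C01"
    using path_in_C01 by blast
next
  fix U assume "U \<in> {U. openin (mtopology_of C01) U}"
  then have U: "openin (Metric_space.mtopology (mspace C01) (mdist C01)) U"
    by (simp add: mtopology_of_def)
  define P where "P = coin_path -` U \<inter> space coin_seq"
  define cyl where "cyl xs = {\<omega> \<in> space coin_seq. \<forall>k\<in>{..<length xs}. \<omega> k = xs ! k}" for xs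
  have "cyl xs \<in> sets coin_seq" for xs
    unfolding cyl_def coin_seq_def
  proof (rule sets.sets_Collect_finite_All)
    fix k :: nat
    have "(\<lambda>\<omega>. \<omega> k) \<in> PiM UNIV (\<lambda>_. uniform_count_measure {0, 1 :: nat}) \<rightarrow>\<^sub>M count_space {0, 1}"
      using measurable_component_singleton[of k UNIV "\<lambda>_. uniform_count_measure {0, 1 :: nat}"]
      by (simp cong: measurable_cong_sets add: sets_uniform_count_measure)
    from measurable_sets[OF this, of "{xs ! k} \<inter> {0, 1}"]
    show "{\<omega> \<in> space (PiM UNIV (\<lambda>_. uniform_count_measure {0, 1 :: nat})). \<omega> k = xs ! k}
        \<in> sets (PiM UNIV (\<lambda>_. uniform_count_measure {0, 1}))"
      by (rule back_subst[of "\<lambda>A. A \<in> _"])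
         (auto simp: space_PiM space_uniform_count_measure PiE_def Pi_def)
  qed auto
  moreover have "P = (\<Union>xs\<in>{xs. cyl xs \<subseteq> P}. cyl xs)"
  proof (intro equalityI subsetI)
    fix \<omega> assume w: "\<omega> \<in> P"
    then obtain r where r: "r > 0" "Metric_space.mball (mspace C01) (mdist C01) (coin_path \<omega>) r \<subseteq> U"
      using U unfolding Metric_space.openin_mtopology[OF Metric_space_mspace_mdist] P_def by blast
    obtain n where n: "(1/2::real) ^ n < r"
      using real_arch_pow_inv[OF r(1), of "1/2"] by auto
    have "cyl (map \<omega> [0..<n]) \<subseteq> P"
    proof
      fix \<eta> assume e: "\<eta> \<in> cyl (map \<omega> [0..<n])"
      then have "mdist C01 (coin_path \<omega>) (coin_path \<eta>) < r"
        using path_dist[of \<omega> \<eta> n] w n by (auto simp: cyl_def P_def)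
      then have "coin_path \<eta> \<in> U"
        using r(2) path_in_C01[of \<omega>] path_in_C01[of \<eta>] w e
        by (auto simp: Metric_space.in_mball[OF Metric_space_mspace_mdist] cyl_def P_def)
      then show "\<eta> \<in> P" using e by (simp add: P_def cyl_def)
    qed
    moreover have "\<omega> \<in> cyl (map \<omega> [0..<n])"
      using w by (simp add: cyl_def P_def)
    ultimately show "\<omega> \<in> (\<Union>xs\<in>{xs. cyl xs \<subseteq> P}. cyl xs)" by blast
  qed blast
  ultimately show "coin_path -` U \<inter> space coin_seq \<in> sets coin_seq"
    unfolding P_def[symmetric]
    by (metis (no_types, lifting) sets.countable_UN'' countableI_type)
qed

end

theory Submission
  imports Defs
begin

text \<open>
  On the interval between two consecutive knots, \<open>t\<^sub>k\<close> and \<open>t\<^sub>k\<^sub>+\<^sub>1\<close>, the construction only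
  offers finitely many curves to follow: before reaching \<open>t\<^sub>k\<close> a path has spelled out a binary
  number \<open>m / 2 ^ k\<close>, and its next digit \<open>e\<close> decides between staying at this height and moving
  up with unit slope. These \<open>2 ^ (k + 1)\<close> branches (scaled by \<open>1 - t\<close>) do not meet inside the
  interval.

  The marginal \<open>\<mu>\<^sub>t\<close> is carried by the finite set of heights of the branches at time \<open>t\<close>. Hence
  almost every path of a measure with these marginals visits a branch at every rational time.
  By continuity it does so at every time, and since the branches are disjoint and the
  interval is connected, it follows a single branch between any two consecutive knots. The
  choices on consecutive intervals fit together at the knots, so the path is one of the
  \<open>\<gamma>\<^sub>\<omega>\<close> (lemma \<open>coin_path_if_visits_branches\<close>).

  It remains to find the law of \<open>\<omega>\<close>. The height of \<open>\<gamma>\<^sub>\<omega>\<close> at the knot \<open>t\<^sub>n\<close> is a binary number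
  whose digits are \<open>\<omega>\<^sub>0, \<dots>, \<omega>\<^sub>n\<^sub>-\<^sub>1\<close>: the present remembers the past. So the joint law of the
  first \<open>n\<close> digits is determined by the single marginal at \<open>t\<^sub>n\<close> (lemma
  \<open>law_of_digits_unique\<close>), and these joint laws determine the law of \<open>\<omega>\<close>, hence that of
  \<open>\<gamma>\<^sub>\<omega>\<close>.
\<close>

section \<open>The branches of the coin paths\<close>

lemma knot_eq: "knot k = 1 - 1 / 2 ^ k"
  by (induction k) (auto simp: field_simps)

lemma knot_mono: "j \<le> k \<Longrightarrow> knot j \<le> knot k"
  by (simp add: knot_eq field_simps)

lemma knot_in_unit: "knot k \<in> {0..1}"
  by (simp add: knot_eq)

lemma between_knots:
  assumes "0 \<le> t" "t < 1"
  obtains k where "knot k \<le> t" "t \<le> knot (Suc k)"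
proof -
  obtain n where "(1/2::real) ^ n < 1 - t"
    using real_arch_pow_inv[of "1 - t" "1/2"] assms by auto
  then have n: "t < knot n"
    by (simp add: knot_eq power_one_over)
  define k where "k = (LEAST n. t < knot n)"
  have k: "t < knot k"
    unfolding k_def by (rule LeastI) (rule n)
  with assms have "k \<noteq> 0"
    by (cases k) auto
  then obtain j where j: "k = Suc j"
    by (cases k) auto
  have "\<not> t < knot j"
    using not_less_Least[of j "\<lambda>n. t < knot n"] j by (simp add: k_def)
  with k j show ?thesis
    by (intro that[of j]) auto
qed

primrec binary_prefix :: "nat \<Rightarrow> (nat \<Rightarrow> nat) \<Rightarrow> nat" where
  "binary_prefix 0 \<omega> = 0"
| "binary_prefix (Suc k) \<omega> = 2 * binary_prefix k \<omega> + \<omega> k"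

definition branch :: "nat \<Rightarrow> nat \<Rightarrow> nat \<Rightarrow> real \<Rightarrow> real" where
  "branch k m e t = (1 - t) * (real m / 2 ^ k + real e * (t - knot k))"

lemma coin_seq_digit: "\<omega> \<in> space coin_seq \<Longrightarrow> \<omega> k \<in> {0, 1}"
  by (auto simp: space_coin_seq PiE_def Pi_def)

lemma binary_prefix_less:
  assumes "\<omega> \<in> space coin_seq"
  shows "binary_prefix k \<omega> < 2 ^ k"
proof (induction k)
  case (Suc k)
  then show ?case using coin_seq_digit[OF assms, of k] by auto
qed simp

lemma binary_prefix_eq_sum: "real (binary_prefix k \<omega>) / 2 ^ k = (\<Sum>j<k. real (\<omega> j) / 2 ^ Suc j)"
  by (induction k) (simp_all add: add_divide_distrib flip: of_nat_mult)

lemma coin_path_eq_branch: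
  assumes t: "knot k \<le> t" "t \<le> knot (Suc k)"
  shows "coin_path \<omega> t = branch k (binary_prefix k \<omega>) (\<omega> k) t"
proof -
  define a where "a j = real (\<omega> j) * min (max (t - knot j) 0) (knot (Suc j) - knot j)" for j
  have later: "a j = 0" if "j \<notin> {..<Suc k}" for j
    using knot_mono[of "Suc k" j] that t by (auto simp: a_def)
  have earlier: "a j = real (\<omega> j) / 2 ^ Suc j" if "j < k" for j
  proof -
    have "knot j + 1 / 2 ^ Suc j \<le> t"
      using knot_mono[of "Suc j" k] that t by simp
    then have "min (max (t - knot j) 0) (knot (Suc j) - knot j) = 1 / 2 ^ Suc j"
      by (subst min_absorb2) auto
    then show ?thesis by (simp only: a_def) simp
  qed
  have current: "a k = real (\<omega> k) * (t - knot k)"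
    using t by (simp add: a_def min_def max_def)
  have "coin_path_tilde \<omega> t = (\<Sum>j. a j)"
    by (simp only: coin_path_tilde_def a_def)
  also have "\<dots> = (\<Sum>j<Suc k. a j)"
    by (rule suminf_finite) (use later in auto)
  also have "\<dots> = real (binary_prefix k \<omega>) / 2 ^ k + real (\<omega> k) * (t - knot k)"
    using earlier current by (simp add: binary_prefix_eq_sum)
  finally show ?thesis
    using t knot_in_unit[of k] knot_in_unit[of "Suc k"] by (simp add: coin_path_def branch_def)
qed

text \<open>
  Divide by \<open>1 - t\<close>. The branches start on the grid of multiples of \<open>1 / 2 ^ k\<close>, and inside
  the interval the rising ones are above their starting point by less than half of the grid
  size, so they are strictly between two grid points, where the constant ones never are.
\<close>

lemma branches_disjoint:
  assumes "knot k < t" "t < knot (Suc k)" "e \<in> {0, 1}" "e' \<in> {0, 1}"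
    and eq: "branch k m e t = branch k m' e' t"
  shows "m = m' \<and> e = e'"
proof -
  define s where "s = 2 ^ k * (t - knot k)"
  have s: "0 < s" "s < 1"
    using assms(1,2) by (simp_all add: s_def field_simps)
  have "t < 1"
    using assms(2) knot_in_unit[of "Suc k"] by (simp del: knot.simps)
  with eq have "real m / 2 ^ k + real e * (t - knot k) = real m' / 2 ^ k + real e' * (t - knot k)"
    by (simp add: branch_def)
  then have "2 ^ k * (real m / 2 ^ k + real e * (t - knot k))
      = 2 ^ k * (real m' / 2 ^ k + real e' * (t - knot k))"
    by simp
  then have *: "real m + real e * s = real m' + real e' * s"
    by (simp add: s_def algebra_simps)
  show ?thesis
  proof (cases "e = e'")
    case True
    with * show ?thesis by simp
  next
    case False
    with * assms(3,4) have "real m - real m' = s \<or> real m' - real m = s"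
      by auto
    then have "real_of_int (int m - int m') = s \<or> real_of_int (int m' - int m) = s"
      by simp
    moreover have "\<not> real_of_int i = s" for i
    proof
      assume "real_of_int i = s"
      with s have "0 < i" "i < 1" by auto
      then show False by simp
    qed
    ultimately show ?thesis by blast
  qed
qed

lemma branch_knot: "branch k m e (knot k) = real m / 4 ^ k"
  by (simp add: branch_def knot_eq flip: power_mult_distrib)

lemma branch_knot_Suc: "branch k m e (knot (Suc k)) = real (2 * m + e) / 4 ^ Suc k"
proof -
  have "branch k m e (knot (Suc k)) = (1 / 2 ^ Suc k) * (real (2 * m + e) / 2 ^ Suc k)"
    by (simp add: branch_def knot_eq field_simps)
  then show ?thesis
    by (simp flip: power_mult_distrib)
qed

lemma finite_coin_path_values:
  assumes "t \<in> {0..1}"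
  shows "finite ((\<lambda>\<omega>. coin_path \<omega> t) ` space coin_seq)"
proof (cases "t = 1")
  case True
  then have "(\<lambda>\<omega>. coin_path \<omega> t) ` space coin_seq \<subseteq> {0}"
    by (auto simp: coin_path_def)
  then show ?thesis by (rule finite_subset) simp
next
  case False
  then obtain k where k: "knot k \<le> t" "t \<le> knot (Suc k)"
    using between_knots[of t] assms by auto
  have "(\<lambda>\<omega>. coin_path \<omega> t) ` space coin_seq \<subseteq> (\<lambda>(m, e). branch k m e t) ` ({..<2 ^ k} \<times> {0, 1})"
  proof (rule image_subsetI)
    fix \<omega> assume w: "\<omega> \<in> space coin_seq"
    show "coin_path \<omega> t \<in> (\<lambda>(m, e). branch k m e t) ` ({..<2 ^ k} \<times> {0, 1})"
      unfolding coin_path_eq_branch[OF k] using coin_seq_digit[OF w, of k] binary_prefix_less[OF w, of k]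
      by (intro image_eqI[of _ _ "(binary_prefix k \<omega>, \<omega> k)"]) auto
  qed
  then show ?thesis by (rule finite_subset) auto
qed

section \<open>A continuous path through the branches is a coin path\<close>

text \<open>
  The times at which \<open>g\<close> agrees with a given branch form a closed set. There are finitely many
  of these sets, they are disjoint, and, being closed, they cover the interval as soon as they
  contain its rational points; so each of them is also open, and connectedness leaves only one.
\<close>

lemma follows_single_branch:
  fixes g :: "real \<Rightarrow> real" and f :: "'i \<Rightarrow> real \<Rightarrow> real"
  assumes "a < b" and "finite I"
    and g: "continuous_on {a..b} g"
    and f: "\<And>i. i \<in> I \<Longrightarrow> continuous_on {a..b} (f i)"
    and disj: "\<And>i j t. \<lbrakk>i \<in> I; j \<in> I; a < t; t < b; f i t = f j t\<rbrakk> \<Longrightarrow> i = j"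
    and visits: "\<And>t. \<lbrakk>t \<in> \<rat>; a < t; t < b\<rbrakk> \<Longrightarrow> \<exists>i\<in>I. g t = f i t"
  shows "\<exists>i\<in>I. \<forall>t\<in>{a..b}. g t = f i t"
proof -
  define A where "A i = {t \<in> {a<..<b}. g t - f i t \<in> {0}}" for i
  have cont: "continuous_on {a<..<b} (\<lambda>t. g t - f i t)" if "i \<in> I" for i
    by (intro continuous_on_diff continuous_on_subset[OF g] continuous_on_subset[OF f[OF that]]) auto
  have clA: "closedin (top_of_set {a<..<b}) (A i)" if "i \<in> I" for i
    using continuous_closedin_preimage[OF cont[OF that], of "{0}"] by (simp add: A_def vimage_def Int_def)
  have cover: "(\<Union>i\<in>I. A i) = {a<..<b}"
  proof (rule ccontr)
    assume ne: "\<not> ?thesis"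
    have "closedin (top_of_set {a<..<b}) (\<Union>i\<in>I. A i)"
      using clA \<open>finite I\<close> by (intro closedin_Union) auto
    then have "openin (top_of_set {a<..<b}) ({a<..<b} - (\<Union>i\<in>I. A i))"
      by (simp add: openin_diff)
    then have op: "open ({a<..<b} - (\<Union>i\<in>I. A i))"
      by (rule openin_open_trans) simp
    have "{a<..<b} - (\<Union>i\<in>I. A i) \<noteq> {}"
      using ne by (auto simp: A_def)
    then have "({a<..<b} - (\<Union>i\<in>I. A i)) \<inter> \<rat> \<noteq> {}"
      using open_Int_closure_eq_empty[OF op, of "\<rat>"] by (simp add: Rats_closure_real)
    then obtain t where "t \<in> \<rat>" "t \<in> {a<..<b} - (\<Union>i\<in>I. A i)"
      by blast
    with visits[of t] show False
      by (auto simp: A_def)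
  qed
  obtain c where c: "c \<in> {a<..<b}"
    using dense[OF \<open>a < b\<close>] by auto
  with cover obtain i where i: "i \<in> I" "c \<in> A i"
    by blast
  have "A i \<inter> A j = {}" if "j \<in> I - {i}" for j
    using disj[of j i] i(1) that by (auto simp: A_def)
  then have "A i = {a<..<b} - (\<Union>j\<in>I - {i}. A j)"
    using i(1) unfolding cover[symmetric] by blast
  moreover have "closedin (top_of_set {a<..<b}) (\<Union>j\<in>I - {i}. A j)"
    using clA \<open>finite I\<close> by (intro closedin_Union) auto
  ultimately have "openin (top_of_set {a<..<b}) (A i)"
    by (simp add: openin_diff)
  with clA[OF i(1)] have "A i = {} \<or> A i = {a<..<b}"
    using connected_clopen[of "{a<..<b}"] by auto
  with i(2) have all: "A i = {a<..<b}"
    by auto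
  have cl: "closure {a<..<b} = {a..b}"
    using \<open>a < b\<close> by simp
  have diff: "continuous_on (closure {a<..<b}) (\<lambda>t. g t - f i t)"
    unfolding cl by (intro continuous_on_diff g f i(1))
  have zero: "g t - f i t = 0" if "t \<in> {a<..<b}" for t
    using that unfolding all[symmetric] by (simp add: A_def)
  have "g t - f i t = 0" if "t \<in> {a..b}" for t
    using continuous_constant_on_closure[OF diff zero, of t] that unfolding cl by simp
  with i(1) show ?thesis
    by force
qed

lemma coin_path_if_visits_branches:
  assumes g: "\<gamma> \<in> mspace C01"
    and visits: "\<And>t. t \<in> \<rat> \<inter> {0..1} \<Longrightarrow> \<gamma> t \<in> (\<lambda>\<omega>. coin_path \<omega> t) ` space coin_seq"
  shows "\<gamma> \<in> coin_path ` space coin_seq"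
proof -
  have cont: "continuous_on {0..1} \<gamma>" and ext: "\<gamma> \<in> extensional {0..1}"
    using g by (auto simp: mspace_C01)
  have "\<exists>i\<in>{..<2 ^ k} \<times> {0, 1}. \<forall>t\<in>{knot k..knot (Suc k)}. \<gamma> t = branch k (fst i) (snd i) t" for k
  proof (rule follows_single_branch)
    show "continuous_on {knot k..knot (Suc k)} \<gamma>"
      by (rule continuous_on_subset[OF cont])
         (use knot_in_unit[of k] knot_in_unit[of "Suc k"] in auto)
    show "continuous_on {knot k..knot (Suc k)} (branch k (fst i) (snd i))" for i
      unfolding branch_def by (intro continuous_intros) auto
    show "i = j" if "i \<in> {..<2 ^ k} \<times> {0, 1}" "j \<in> {..<2 ^ k} \<times> {0, 1}" "knot k < t" "t < knot (Suc k)"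
        "branch k (fst i) (snd i) t = branch k (fst j) (snd j) t" for i j t
      using branches_disjoint[OF that(3,4) _ _ that(5)] that(1,2) by (auto simp: prod_eq_iff)
    show "\<exists>i\<in>{..<2 ^ k} \<times> {0, 1}. \<gamma> t = branch k (fst i) (snd i) t"
      if t: "t \<in> \<rat>" "knot k < t" "t < knot (Suc k)" for t
    proof -
      have "t \<in> \<rat> \<inter> {0..1}"
        using t knot_in_unit[of k] knot_in_unit[of "Suc k"] by auto
      then obtain \<omega> where w: "\<omega> \<in> space coin_seq" "\<gamma> t = coin_path \<omega> t"
        using visits by blast
      then show ?thesis
        using coin_path_eq_branch[of k t \<omega>] t coin_seq_digit[OF w(1), of k] binary_prefix_less[OF w(1), of k]
        by (intro bexI[of _ "(binary_prefix k \<omega>, \<omega> k)"]) auto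
    qed
  qed auto
  then obtain i where i: "\<And>k. i k \<in> {..<2 ^ k} \<times> {0, 1}"
    and path: "\<And>k t. t \<in> {knot k..knot (Suc k)} \<Longrightarrow> \<gamma> t = branch k (fst (i k)) (snd (i k)) t"
    by metis
  define \<omega> where "\<omega> k = snd (i k)" for k
  have w: "\<omega> \<in> space coin_seq"
  proof -
    have "\<omega> k \<in> {0, 1}" for k
      using i[of k] unfolding \<omega>_def mem_Times_iff by blast
    then show ?thesis
      by (simp add: space_coin_seq PiE_UNIV_domain)
  qed
  \<comment> \<open>Both intervals adjacent to a knot give the height of the path there.\<close>
  have step: "fst (i (Suc k)) = 2 * fst (i k) + \<omega> k" for k
  proof -
    have "real (fst (i (Suc k))) / 4 ^ Suc k = real (2 * fst (i k) + \<omega> k) / 4 ^ Suc k"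
      using path[of "knot (Suc k)" k] path[of "knot (Suc k)" "Suc k"]
        knot_mono[of k "Suc k"] knot_mono[of "Suc k" "Suc (Suc k)"]
      by (simp add: branch_knot branch_knot_Suc \<omega>_def del: knot.simps power_Suc)
    then show ?thesis
      by (simp only: divide_cancel_right of_nat_eq_iff) simp
  qed
  have prefix: "fst (i k) = binary_prefix k \<omega>" for k
  proof (induction k)
    case 0
    then show ?case using i[of 0] by (auto simp: mem_Times_iff)
  qed (simp add: step)
  have "\<gamma> t = coin_path \<omega> t" for t
  proof (cases "t \<in> {0..1}")
    case True
    show ?thesis
    proof (cases "t = 1")
      case True
      then show ?thesis using visits[of 1] by (auto simp: coin_path_def)
    next
      case False
      with True obtain k where k: "knot k \<le> t" "t \<le> knot (Suc k)"
        using between_knots[of t] by auto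
      then show ?thesis
        using path[of t k] by (simp add: coin_path_eq_branch[OF k] prefix \<omega>_def)
    qed
  next
    case False
    then show ?thesis using ext by (auto simp: coin_path_def extensional_def)
  qed
  with w show ?thesis by blast
qed

section \<open>Reading the digits off a path\<close>

text \<open>
  Meant for \<open>n > k\<close> and the height \<open>x\<close> of a coin path at \<open>t\<^sub>n\<close>. There the first \<open>n\<close> digits,
  read as an integer, have been divided by \<open>2 ^ n\<close> and then scaled by \<open>1 - t\<^sub>n = 1 / 2 ^ n\<close>,
  which the factor \<open>4 ^ n\<close> undoes.
\<close>

definition digit_from :: "nat \<Rightarrow> nat \<Rightarrow> real \<Rightarrow> nat" where
  "digit_from n k x = nat \<lfloor>4 ^ n * x\<rfloor> div 2 ^ (n - Suc k) mod 2"

definition digits :: "(real \<Rightarrow> real) \<Rightarrow> nat \<Rightarrow> nat" where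
  "digits \<gamma> k = digit_from (Suc k) k (\<gamma> (knot (Suc k)))"

lemma binary_prefix_digit:
  assumes "\<omega> \<in> space coin_seq" "k < n"
  shows "binary_prefix n \<omega> div 2 ^ (n - Suc k) mod 2 = \<omega> k"
  using assms(2)
proof (induction n)
  case (Suc n)
  note w = coin_seq_digit[OF assms(1), of n]
  show ?case
  proof (cases "k = n")
    case True
    then show ?thesis using w by auto
  next
    case False
    with Suc.prems have "k < n" by simp
    then have "Suc n - Suc k = Suc (n - Suc k)" by simp
    moreover have "binary_prefix (Suc n) \<omega> div 2 = binary_prefix n \<omega>"
      using w by auto
    ultimately show ?thesis
      using Suc.IH[OF \<open>k < n\<close>] by (simp only: power_Suc div_mult2_eq)
  qed
qed simp

text \<open>
  Every later knot remembers the digit: this is why one marginal controls a joint law.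
\<close>

lemma digit_from_coin_path:
  assumes "\<omega> \<in> space coin_seq" "k < n"
  shows "digit_from n k (coin_path \<omega> (knot n)) = \<omega> k"
proof -
  have "coin_path \<omega> (knot n) = real (binary_prefix n \<omega>) / 4 ^ n"
    by (simp only: coin_path_eq_branch[of n "knot n", OF order_refl knot_mono[of n "Suc n"], simplified]
        branch_knot)
  then show ?thesis
    using binary_prefix_digit[OF assms] by (simp add: digit_from_def)
qed

lemma digits_coin_path:
  assumes "\<omega> \<in> space coin_seq"
  shows "digits (coin_path \<omega>) = \<omega>"
  unfolding digits_def using digit_from_coin_path[OF assms lessI] by blast

lemma measurable_digit_from [measurable]: "digit_from n k \<in> borel \<rightarrow>\<^sub>M count_space UNIV"
  unfolding digit_from_def by measurable

lemma measurable_digits: "digits \<in> borel_C01 \<rightarrow>\<^sub>M coin_seq"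
  unfolding coin_seq_def
proof (rule measurable_PiM_single')
  fix k :: nat
  have "(\<lambda>\<gamma>. digit_from (Suc k) k (eval_at (knot (Suc k)) \<gamma>)) \<in> borel_C01 \<rightarrow>\<^sub>M count_space UNIV"
    by (rule measurable_compose[OF measurable_eval_at[OF knot_in_unit] measurable_digit_from])
  then have "(\<lambda>\<gamma>. digits \<gamma> k) \<in> borel_C01 \<rightarrow>\<^sub>M count_space UNIV"
    by (simp only: digits_def eval_at_def)
  then have "(\<lambda>\<gamma>. digits \<gamma> k) \<in> borel_C01 \<rightarrow>\<^sub>M count_space {0, 1}"
    by (rule measurable_count_space_extend[rotated 2]) (auto simp: digits_def digit_from_def)
  then show "(\<lambda>\<gamma>. digits \<gamma> k) \<in> borel_C01 \<rightarrow>\<^sub>M uniform_count_measure {0, 1}"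
    by (simp cong: measurable_cong_sets add: sets_uniform_count_measure)
qed (auto simp: space_uniform_count_measure digits_def digit_from_def)

section \<open>Measures with the prescribed marginals\<close>

text \<open>
  A marginal controls the path at one time only; restricting to rational times keeps the union of
  the exceptional null sets null.
\<close>

lemma AE_lifting_coin_path:
  assumes "admissible_lifting marginal l"
  shows "AE \<gamma> in l. \<gamma> \<in> coin_path ` space coin_seq"
proof -
  have sets: "sets l = sets borel_C01"
    using assms by (auto simp: admissible_lifting_def space_prob_algebra)
  then have space: "space l = mspace C01"
    by (metis sets_eq_imp_space_eq space_borel_C01)
  have "AE \<gamma> in l. \<gamma> t \<in> (\<lambda>\<omega>. coin_path \<omega> t) ` space coin_seq" (is "AE \<gamma> in l. \<gamma> t \<in> ?R")
    if t: "t \<in> \<rat> \<inter> {0..1}" for t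
  proof -
    have R [measurable]: "?R \<in> sets borel"
      using finite_coin_path_values[of t] t by (intro borel_closed finite_imp_closed) auto
    have e: "eval_at t \<in> borel_C01 \<rightarrow>\<^sub>M borel" "eval_at t \<in> l \<rightarrow>\<^sub>M borel"
      using measurable_eval_at[of t] t sets by (auto cong: measurable_cong_sets)
    have "AE \<omega> in coin_seq. eval_at t (coin_path \<omega>) \<in> ?R"
      by (rule AE_I2) (simp add: eval_at_def)
    moreover have marginal: "marginal t = distr coin_seq borel (eval_at t \<circ> coin_path)"
      unfolding marginal_def path_law_def by (rule distr_distr[OF e(1) measurable_path])
    ultimately have support: "AE x in marginal t. x \<in> ?R"
      unfolding marginal
      by (subst AE_distr_iff[OF measurable_comp[OF measurable_path e(1)]]) (use R in auto)
    have law: "distr l borel (eval_at t) = marginal t"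
      using assms t by (auto simp: admissible_lifting_def)
    have "AE x in distr l borel (eval_at t). x \<in> ?R"
      unfolding law by (rule support)
    then have "AE \<gamma> in l. eval_at t \<gamma> \<in> ?R"
      by (rule AE_distrD[OF e(2)])
    then show ?thesis
      by (simp only: eval_at_def)
  qed
  moreover have "countable (\<rat> \<inter> {0..1} :: real set)"
    using countable_rat by blast
  ultimately have "AE \<gamma> in l. \<forall>t\<in>\<rat> \<inter> {0..1}. \<gamma> t \<in> (\<lambda>\<omega>. coin_path \<omega> t) ` space coin_seq"
    by (subst AE_ball_countable) auto
  then show ?thesis
    using AE_space by eventually_elim (rule coin_path_if_visits_branches, auto simp: space)
qed

text \<open>
  A cylinder condition on finitely many digits is almost surely a condition on the position of
  the path at one knot that lies beyond all of them.
\<close>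

lemma law_of_digits_unique:
  assumes "admissible_lifting marginal l1" "admissible_lifting marginal l2"
  shows "distr l1 coin_seq digits = distr l2 coin_seq digits"
proof -
  let ?U = "\<lambda>_::nat. uniform_count_measure {0, 1 :: nat}"
  define B where "B n J A = {x. \<forall>k\<in>J. digit_from n k x \<in> A k}" for n J and A :: "nat \<Rightarrow> nat set"
  have B: "B n J A \<in> sets borel" if "finite J" for n J A
  proof -
    have "{x \<in> space borel. digit_from n k x \<in> A k} \<in> sets borel" for k
      by measurable
    then have "{x \<in> space borel. \<forall>k\<in>J. digit_from n k x \<in> A k} \<in> sets borel"
      using that by (intro sets.sets_Collect_finite_All) auto
    then show ?thesis by (simp add: B_def)
  qed
  have cyl: "emeasure (distr l coin_seq digits) (prod_emb UNIV ?U J (Pi\<^sub>E J A))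
      = emeasure (marginal (knot n)) (B n J A)"
    if l: "admissible_lifting marginal l" and J: "finite J" "J \<subseteq> {..<n}"
      and A: "\<And>k. k \<in> J \<Longrightarrow> A k \<in> sets (?U k)" for l J n A
  proof -
    have sets: "sets l = sets borel_C01"
      using l by (auto simp: admissible_lifting_def space_prob_algebra)
    then have d: "digits \<in> l \<rightarrow>\<^sub>M coin_seq" and e: "eval_at (knot n) \<in> l \<rightarrow>\<^sub>M borel"
      using measurable_digits measurable_eval_at[OF knot_in_unit] by (auto cong: measurable_cong_sets)
    have emb: "prod_emb UNIV ?U J (Pi\<^sub>E J A) \<in> sets coin_seq"
      unfolding coin_seq_def using J A by (intro sets_PiM_I) auto
    have "emeasure (distr l coin_seq digits) (prod_emb UNIV ?U J (Pi\<^sub>E J A))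
        = emeasure l (digits -` prod_emb UNIV ?U J (Pi\<^sub>E J A) \<inter> space l)"
      by (rule emeasure_distr[OF d emb])
    also have "\<dots> = emeasure l (eval_at (knot n) -` B n J A \<inter> space l)"
    proof (rule emeasure_eq_AE)
      show "AE \<gamma> in l. (\<gamma> \<in> digits -` prod_emb UNIV ?U J (Pi\<^sub>E J A) \<inter> space l)
          = (\<gamma> \<in> eval_at (knot n) -` B n J A \<inter> space l)"
        using AE_lifting_coin_path[OF l]
      proof (rule AE_mp, intro AE_I2 impI)
        fix \<gamma> assume "\<gamma> \<in> space l" "\<gamma> \<in> coin_path ` space coin_seq"
        then obtain \<omega> where w: "\<omega> \<in> space coin_seq" "\<gamma> = coin_path \<omega>"
          by blast
        have "digits \<gamma> \<in> prod_emb UNIV ?U J (Pi\<^sub>E J A) \<longleftrightarrow> (\<forall>k\<in>J. \<omega> k \<in> A k)"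
          using w by (auto simp: digits_coin_path prod_emb_iff space_uniform_count_measure
              space_coin_seq PiE_iff)
        also have "\<dots> \<longleftrightarrow> eval_at (knot n) \<gamma> \<in> B n J A"
          using w J(2) by (auto simp: B_def eval_at_def digit_from_coin_path subset_eq)
        finally show "(\<gamma> \<in> digits -` prod_emb UNIV ?U J (Pi\<^sub>E J A) \<inter> space l)
            = (\<gamma> \<in> eval_at (knot n) -` B n J A \<inter> space l)"
          by simp
      qed
    qed (use measurable_sets[OF d emb] measurable_sets[OF e B[OF J(1)]] in auto)
    also have "\<dots> = emeasure (distr l borel (eval_at (knot n))) (B n J A)"
      by (rule emeasure_distr[OF e B[OF J(1)], symmetric])
    also have "distr l borel (eval_at (knot n)) = marginal (knot n)"
      using l knot_in_unit by (simp add: admissible_lifting_def)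
    finally show ?thesis .
  qed
  show ?thesis
  proof (rule measure_eqI_PiM_infinite[where I = UNIV and M = ?U])
    fix A and J :: "nat set"
    assume J: "finite J" and A: "\<And>k. k \<in> J \<Longrightarrow> A k \<in> sets (?U k)"
    obtain n where n: "J \<subseteq> {..<n}"
      using J finite_nat_iff_bounded by blast
    show "emeasure (distr l1 coin_seq digits) (prod_emb UNIV ?U J (Pi\<^sub>E J A))
        = emeasure (distr l2 coin_seq digits) (prod_emb UNIV ?U J (Pi\<^sub>E J A))"
      using cyl[OF assms(1) J n A] cyl[OF assms(2) J n A] by simp
  next
    have l1: "prob_space l1" "sets l1 = sets borel_C01"
      using assms(1) by (auto simp: admissible_lifting_def space_prob_algebra)
    have "digits \<in> l1 \<rightarrow>\<^sub>M coin_seq"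
      using measurable_digits l1(2) by (simp cong: measurable_cong_sets)
    then show "finite_measure (distr l1 coin_seq digits)"
      using prob_space.prob_space_distr[OF l1(1)] prob_space.finite_measure by blast
  qed (simp_all add: coin_seq_def)
qed

text \<open>
  On the coin paths, which have full measure, \<open>digits\<close> is inverted by \<open>coin_path\<close>. Pushing the
  measure through both maps therefore does not change it.
\<close>

lemma lifting_eq_law_of_digits:
  assumes "admissible_lifting marginal l"
  shows "l = distr (distr l coin_seq digits) borel_C01 coin_path"
proof -
  have sets: "sets l = sets borel_C01"
    using assms by (auto simp: admissible_lifting_def space_prob_algebra)
  then have d: "digits \<in> l \<rightarrow>\<^sub>M coin_seq"
    using measurable_digits by (simp cong: measurable_cong_sets)
  have "AE \<gamma> in l. (coin_path \<circ> digits) \<gamma> = \<gamma>"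
    using AE_lifting_coin_path[OF assms] by (rule AE_mp) (auto intro!: AE_I2 simp: digits_coin_path)
  then have "distr l borel_C01 (coin_path \<circ> digits) = distr l borel_C01 (\<lambda>\<gamma>. \<gamma>)"
    using measurable_comp[OF d measurable_path] sets
    by (intro distr_cong_AE) (auto simp: measurable_ident_sets)
  also have "\<dots> = l"
    using sets by (simp add: distr_id2)
  finally show ?thesis
    by (simp add: distr_distr[OF measurable_path d])
qed

lemma lifting_unique:
  assumes "admissible_lifting marginal l1" "admissible_lifting marginal l2"
  shows "l1 = l2"
proof -
  have "l1 = distr (distr l1 coin_seq digits) borel_C01 coin_path"
    by (rule lifting_eq_law_of_digits[OF assms(1)])
  also have "\<dots> = distr (distr l2 coin_seq digits) borel_C01 coin_path"
    by (simp only: law_of_digits_unique[OF assms])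
  also have "\<dots> = l2"
    by (rule lifting_eq_law_of_digits[OF assms(2), symmetric])
  finally show ?thesis .
qed

lemma admissible_lifting_path_law: "admissible_lifting marginal path_law"
proof -
  have "prob_space coin_seq"
    unfolding coin_seq_def by (intro prob_space_PiM prob_space_uniform_count_measure) auto
  then have "prob_space path_law"
    unfolding path_law_def by (rule prob_space.prob_space_distr) (rule measurable_path)
  then show ?thesis
    by (simp add: admissible_lifting_def space_prob_algebra path_law_def marginal_def)
qed

theorem lemma3p3:
  shows "(\<forall>l1\<in>space (prob_algebra borel_C01). \<forall>l2\<in>space (prob_algebra borel_C01).
           (\<forall>t\<in>{0..1}. distr l1 borel (eval_at t) = marginal t \<and> distr l2 borel (eval_at t) = marginal t)
             \<longrightarrow> l1 = l2)
       \<and> {l. admissible_lifting marginal l} = {path_law}"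
proof
  show "{l. admissible_lifting marginal l} = {path_law}"
    using lifting_unique admissible_lifting_path_law by blast
qed (use lifting_unique in \<open>unfold admissible_lifting_def, blast\<close>)

end
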